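(* Let $d\ge 1$, let $\mathcal{H}=L_2(\mathbb{R}^d)$ be the complex Hilbert space of square-integrable functions with respect to Lebesgue measure, and let $u\in\mathcal{H}$. Let $\{\xi_n\}_{n\ge 1}$ be independent identically distributed random vectors in $\mathbb{R}^d$, defined on a common probability space $(\Omega,\mathcal{F},\mathrm{P})$, with finite expectation $\mu\in\mathbb{R}^d$. Then the random pure states $\rho\left[S_{\xi_1/n}\cdots S_{\xi_n/n}u\right]$ converge almost surely in the weak operator topology to the pure state $\rho[S_\mu u]$; that is, for every bounded linear operator $A\in B(\mathcal{H})$, $$\operatorname{tr}\left(\rho\left[S_{\xi_1/n}\cdots S_{\xi_n/n}u\right]A\right)\xrightarrow[n\to\infty]{\text{a.s.}}\operatorname{tr}\left(\rho[S_\mu u]A\right).$$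
   Context: For $a\in\mathbb{R}^d$, the shift operator $S_a:\mathcal{H}\to\mathcal{H}$ is $(S_a u)(x):=u(x+a)$. For $u\in\mathcal{H}$ (not necessarily of norm one), the pure state $\rho[u]:=|u\rangle\langle u|$ is the trace-class operator $v\mapsto\langle u,v\rangle u$, where $\langle\cdot,\cdot\rangle$ is the inner product of $\mathcal{H}$, linear in the second argument. $B(\mathcal{H})$ is the space of bounded linear operators on $\mathcal{H}$. Random states $\rho_n$ are said to converge almost surely in the weak operator topology (WOT) to $\rho$ if for each $A\in B(\mathcal{H})$ the random variables $\operatorname{tr}(\rho_nA)$ converge almost surely to $\operatorname{tr}(\rho A)$. *)

theory Defs
  imports "HOL-Probability.Probability"
begin

section \<open>The complex Hilbert space of square-integrable functions\<close>

text \<open>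
  Representatives are Borel functions. Every Lebesgue measurable function agrees almost
  everywhere with a Borel one, so the classes below are those of Lebesgue measurable functions.
\<close>

definition square_integrable :: "('a::euclidean_space \<Rightarrow> complex) \<Rightarrow> bool" where
  "square_integrable f \<longleftrightarrow>
     f \<in> borel_measurable lborel \<and> integrable lborel (\<lambda>x. (cmod (f x))\<^sup>2)"

lemma square_integrable_measurable:
  "square_integrable f \<Longrightarrow> f \<in> borel_measurable lborel"
  by (simp add: square_integrable_def)

lemma square_integrable_0: "square_integrable (\<lambda>_. 0)"
  by (simp add: square_integrable_def)

lemma square_integrable_scale:
  assumes "square_integrable f"
  shows "square_integrable (\<lambda>x. c * f x)"
  using assms by (auto simp: square_integrable_def norm_mult power_mult_distrib)

lemma square_integrable_add:
  assumes "square_integrable f" "square_integrable g"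
  shows "square_integrable (\<lambda>x. f x + g x)"
proof -
  note [measurable] = assms[THEN square_integrable_measurable]
  have int: "integrable lborel (\<lambda>x. 2 * (cmod (f x))\<^sup>2 + 2 * (cmod (g x))\<^sup>2)"
    using assms unfolding square_integrable_def
    by (intro Bochner_Integration.integrable_add integrable_mult_right) blast+
  have bound: "(cmod (f x + g x))\<^sup>2 \<le> 2 * (cmod (f x))\<^sup>2 + 2 * (cmod (g x))\<^sup>2" for x
  proof -
    have "(cmod (f x + g x))\<^sup>2 \<le> (cmod (f x) + cmod (g x))\<^sup>2"
      by (intro power_mono norm_triangle_ineq norm_ge_zero)
    also have "\<dots> \<le> 2 * (cmod (f x))\<^sup>2 + 2 * (cmod (g x))\<^sup>2"
      using sum_squares_bound[of "cmod (f x)" "cmod (g x)"] by (simp add: power2_sum)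
    finally show ?thesis .
  qed
  have "integrable lborel (\<lambda>x. (cmod (f x + g x))\<^sup>2)"
  proof (rule Bochner_Integration.integrable_bound[OF int])
    show "(\<lambda>x. (cmod (f x + g x))\<^sup>2) \<in> borel_measurable lborel"
      by measurable
    show "AE x in lborel. norm ((cmod (f x + g x))\<^sup>2)
            \<le> norm (2 * (cmod (f x))\<^sup>2 + 2 * (cmod (g x))\<^sup>2)"
      using bound by (intro AE_I2) (simp del: norm_power)
  qed
  then show ?thesis
    unfolding square_integrable_def by (intro conjI) (measurable)
qed

lemma square_integrable_uminus:
  "square_integrable f \<Longrightarrow> square_integrable (\<lambda>x. - f x)"
  using square_integrable_scale[of f "-1"] by simp

lemma square_integrable_diff:
  "square_integrable f \<Longrightarrow> square_integrable g \<Longrightarrow> square_integrable (\<lambda>x. f x - g x)"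
  using square_integrable_add[of f "\<lambda>x. - g x"] by (simp add: square_integrable_uminus)

lemma square_integrable_shift:
  fixes f :: "'a::euclidean_space \<Rightarrow> complex"
  assumes "square_integrable f"
  shows "square_integrable (\<lambda>x. f (x + a))"
proof -
  note [measurable] = assms[THEN square_integrable_measurable]
  have "integrable (distr lborel borel ((+) a)) (\<lambda>x. (cmod (f x))\<^sup>2)"
    using assms by (simp add: lborel_distr_plus square_integrable_def)
  then have "integrable lborel (\<lambda>x. (cmod (f (a + x)))\<^sup>2)"
    by (rule integrable_distr[rotated]) simp
  then show ?thesis by (simp add: square_integrable_def add.commute)
qed

lemma AE_lborel_shift:
  fixes a :: "'a::euclidean_space"
  assumes "AE x in lborel. P x"
  shows "AE x in lborel. P (x + a)"
proof -
  have "AE x in distr lborel borel ((+) a). P x"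
    using assms by (subst lborel_distr_plus)
  then have "AE x in lborel. P (a + x)"
    by (rule AE_distrD[rotated]) simp
  then show ?thesis by (simp add: add.commute)
qed

lemma square_integrable_mult:
  assumes "square_integrable f" "square_integrable g"
  shows "integrable lborel (\<lambda>x. cnj (f x) * g x)"
proof -
  note [measurable] = assms[THEN square_integrable_measurable]
  have int: "integrable lborel (\<lambda>x. (cmod (f x))\<^sup>2 + (cmod (g x))\<^sup>2)"
    using assms unfolding square_integrable_def
    by (intro Bochner_Integration.integrable_add) blast+
  have bound: "cmod (cnj (f x) * g x) \<le> norm ((cmod (f x))\<^sup>2 + (cmod (g x))\<^sup>2)" for x
  proof -
    have "0 \<le> cmod (f x) * cmod (g x)" by simp
    then show ?thesis
      using sum_squares_bound[of "cmod (f x)" "cmod (g x)"]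
      unfolding norm_mult complex_mod_cnj real_norm_def by linarith
  qed
  have [measurable]: "cnj \<in> borel_measurable borel"
    by (intro borel_measurable_continuous_onI continuous_intros)
  show ?thesis
  proof (rule Bochner_Integration.integrable_bound[OF int])
    show "(\<lambda>x. cnj (f x) * g x) \<in> borel_measurable lborel"
      by measurable
  qed (use bound in \<open>intro AE_I2\<close>)
qed

quotient_type (overloaded) 'a L2 = "'a::euclidean_space \<Rightarrow> complex" / partial:
  "\<lambda>f g. square_integrable f \<and> square_integrable g \<and> (AE x in lborel. f x = g x)"
proof (rule part_equivpI)
  show "\<exists>f::'a \<Rightarrow> complex. square_integrable f \<and> square_integrable f \<and> (AE x in lborel. f x = f x)"
    using square_integrable_0 by auto
  show "symp (\<lambda>f g::'a \<Rightarrow> complex.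
          square_integrable f \<and> square_integrable g \<and> (AE x in lborel. f x = g x))"
  proof (rule sympI, elim conjE, intro conjI)
    fix f g :: "'a \<Rightarrow> complex"
    assume "AE x in lborel. f x = g x"
    then show "AE x in lborel. g x = f x"
      by eventually_elim simp
  qed
  show "transp (\<lambda>f g::'a \<Rightarrow> complex.
          square_integrable f \<and> square_integrable g \<and> (AE x in lborel. f x = g x))"
  proof (rule transpI, elim conjE, intro conjI)
    fix f g h :: "'a \<Rightarrow> complex"
    assume "AE x in lborel. f x = g x" "AE x in lborel. g x = h x"
    then show "AE x in lborel. f x = h x"
      by eventually_elim simp
  qed
qed

instantiation L2 :: (euclidean_space) ab_group_add
begin

lift_definition zero_L2 :: "'a L2" is "\<lambda>_. 0"
  by (simp add: square_integrable_0)

lift_definition plus_L2 :: "'a L2 \<Rightarrow> 'a L2 \<Rightarrow> 'a L2" is "\<lambda>f g x. f x + g x"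
proof (elim conjE, intro conjI)
  fix f f' g g' :: "'a \<Rightarrow> complex"
  assume "AE x in lborel. f x = f' x" "AE x in lborel. g x = g' x"
  then show "AE x in lborel. f x + g x = f' x + g' x"
    by eventually_elim simp
qed (rule square_integrable_add; assumption)+

lift_definition uminus_L2 :: "'a L2 \<Rightarrow> 'a L2" is "\<lambda>f x. - f x"
proof (elim conjE, intro conjI)
  fix f g :: "'a \<Rightarrow> complex"
  assume "AE x in lborel. f x = g x"
  then show "AE x in lborel. - f x = - g x"
    by eventually_elim simp
qed (rule square_integrable_uminus; assumption)+

lift_definition minus_L2 :: "'a L2 \<Rightarrow> 'a L2 \<Rightarrow> 'a L2" is "\<lambda>f g x. f x - g x"
proof (elim conjE, intro conjI)
  fix f f' g g' :: "'a \<Rightarrow> complex"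
  assume "AE x in lborel. f x = f' x" "AE x in lborel. g x = g' x"
  then show "AE x in lborel. f x - g x = f' x - g' x"
    by eventually_elim simp
qed (rule square_integrable_diff; assumption)+

instance
proof
  fix u v w :: "'a L2"
  show "u + v + w = u + (v + w)"
    by transfer (simp add: add.assoc square_integrable_add)
  show "u + v = v + u"
    by transfer (simp add: add.commute square_integrable_add)
  show "0 + u = u" by transfer simp
  show "- u + u = 0" by transfer (simp add: square_integrable_0)
  show "u - v = u + - v"
    by transfer (simp add: square_integrable_diff)
qed

end

lift_definition scaleC :: "complex \<Rightarrow> 'a::euclidean_space L2 \<Rightarrow> 'a L2" (infixr "*\<^sub>C" 75)
  is "\<lambda>c f x. c * f x"
proof (elim conjE, intro conjI)
  fix c and f g :: "'a \<Rightarrow> complex"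
  assume "AE x in lborel. f x = g x"
  then show "AE x in lborel. c * f x = c * g x"
    by eventually_elim simp
qed (rule square_integrable_scale; assumption)+

lemma scaleC_add_right: "c *\<^sub>C (u + v) = c *\<^sub>C u + c *\<^sub>C v"
  by transfer (simp only: distrib_left square_integrable_add square_integrable_scale simp_thms AE_I2)

lemma scaleC_add_left: "(c + d) *\<^sub>C u = c *\<^sub>C u + d *\<^sub>C u"
  by transfer (simp only: distrib_right square_integrable_add square_integrable_scale simp_thms AE_I2)

lemma scaleC_scaleC: "c *\<^sub>C d *\<^sub>C u = (c * d) *\<^sub>C u"
  by transfer (simp only: mult.assoc square_integrable_scale simp_thms AE_I2)

lemma scaleC_one: "1 *\<^sub>C u = u"
  by transfer simp

text \<open>The complex inner product, linear in the second argument.\<close>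

lift_definition cinner :: "'a::euclidean_space L2 \<Rightarrow> 'a L2 \<Rightarrow> complex"
  is "\<lambda>f g. \<integral>x. cnj (f x) * g x \<partial>lborel"
  by (rule integral_cong_AE)
     (blast intro: borel_measurable_integrable square_integrable_mult,
      blast intro: borel_measurable_integrable square_integrable_mult, auto)

lemma cinner_commute: "cinner u v = cnj (cinner v u)"
  by transfer (subst Bochner_Integration.integral_cnj[symmetric], simp add: mult.commute)

lemma cinner_add_right: "cinner u (v + w) = cinner u v + cinner u w"
  by transfer (simp add: distrib_left square_integrable_mult)

lemma cinner_scaleC_right: "cinner u (c *\<^sub>C v) = c * cinner u v"
  by transfer (simp add: mult.left_commute)

lemma cinner_self:
  "cinner u u = of_real (Re (cinner u u))" "Re (cinner u u) \<ge> 0" "cinner u u = 0 \<longleftrightarrow> u = 0"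
proof -
  have *: "cnj z * z = of_real ((cmod z)\<^sup>2)" for z
    by (metis complex_norm_square mult.commute)
  show "cinner u u = of_real (Re (cinner u u))" "Re (cinner u u) \<ge> 0"
    by (transfer, simp add: * del: of_real_power)+
  show "cinner u u = 0 \<longleftrightarrow> u = 0"
    by transfer (auto simp: * square_integrable_def integral_nonneg_eq_0_iff_AE
        simp del: of_real_power)
qed

text \<open>
  The topology of \<open>'a L2\<close> comes from the norm of the underlying real inner product space.
\<close>

instantiation L2 :: (euclidean_space) real_inner
begin

definition scaleR_L2 :: "real \<Rightarrow> 'a L2 \<Rightarrow> 'a L2" where
  "scaleR_L2 r u = of_real r *\<^sub>C u"

definition inner_L2 :: "'a L2 \<Rightarrow> 'a L2 \<Rightarrow> real" where
  "inner_L2 u v = Re (cinner u v)"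

definition norm_L2 :: "'a L2 \<Rightarrow> real" where
  "norm_L2 u = sqrt (inner u u)"

definition sgn_L2 :: "'a L2 \<Rightarrow> 'a L2" where
  "sgn_L2 u = inverse (norm u) *\<^sub>R u"

definition dist_L2 :: "'a L2 \<Rightarrow> 'a L2 \<Rightarrow> real" where
  "dist_L2 u v = norm (u - v)"

definition uniformity_L2 :: "('a L2 \<times> 'a L2) filter" where
  "uniformity_L2 = (INF e\<in>{0<..}. principal {(u, v). dist u v < e})"

definition open_L2 :: "'a L2 set \<Rightarrow> bool" where
  "open_L2 U \<longleftrightarrow> (\<forall>u\<in>U. \<forall>\<^sub>F (u', v) in uniformity. u' = u \<longrightarrow> v \<in> U)"

instance
proof
  fix r s :: real and u v w :: "'a L2"
  show "r *\<^sub>R (u + v) = r *\<^sub>R u + r *\<^sub>R v"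
    unfolding scaleR_L2_def by (rule scaleC_add_right)
  show "(r + s) *\<^sub>R u = r *\<^sub>R u + s *\<^sub>R u"
    unfolding scaleR_L2_def of_real_add by (rule scaleC_add_left)
  show "r *\<^sub>R s *\<^sub>R u = (r * s) *\<^sub>R u"
    unfolding scaleR_L2_def of_real_mult by (rule scaleC_scaleC)
  show "1 *\<^sub>R u = u"
    unfolding scaleR_L2_def of_real_1 by (rule scaleC_one)
  have comm: "inner u v = inner v u" for u v :: "'a L2"
    unfolding inner_L2_def by (subst cinner_commute) (rule cnj.sel)
  then show "inner u v = inner v u" .
  have "inner w (u + v) = inner w u + inner w v"
    by (simp add: inner_L2_def cinner_add_right)
  then show "inner (u + v) w = inner u w + inner v w"
    unfolding comm[of _ w] .
  have "inner v (r *\<^sub>R u) = r * inner v u"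
    by (simp add: inner_L2_def scaleR_L2_def cinner_scaleC_right)
  then show "inner (r *\<^sub>R u) v = r * inner u v"
    unfolding comm[of _ v] .
  show "0 \<le> inner u u"
    unfolding inner_L2_def by (rule cinner_self)
  have "Re (cinner u u) = 0 \<longleftrightarrow> cinner u u = 0"
    by (subst (2) cinner_self(1)) (rule of_real_eq_0_iff[symmetric])
  then show "inner u u = 0 \<longleftrightarrow> u = 0"
    unfolding inner_L2_def cinner_self(3) .
qed (simp_all add: norm_L2_def sgn_L2_def dist_L2_def uniformity_L2_def open_L2_def)

end

interpretation cL2: vector_space "scaleC :: complex \<Rightarrow> 'a::euclidean_space L2 \<Rightarrow> 'a L2"
  by standard (rule scaleC_add_right scaleC_add_left scaleC_scaleC scaleC_one)+

section \<open>Shifts, operators, trace and pure states\<close>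

lift_definition shift_op :: "'a::euclidean_space \<Rightarrow> 'a L2 \<Rightarrow> 'a L2"
  is "\<lambda>a f x. f (x + a)"
  by (elim conjE, intro conjI) (simp_all add: square_integrable_shift, rule AE_lborel_shift)

text \<open>The space $B(\mathcal{H})$ of bounded complex-linear operators.\<close>

definition bounded_operators :: "('a::euclidean_space L2 \<Rightarrow> 'a L2) set" where
  "bounded_operators = {A. bounded_linear A \<and> (\<forall>c v. A (c *\<^sub>C v) = c *\<^sub>C A v)}"

definition orthonormal_basis :: "'a::euclidean_space L2 set \<Rightarrow> bool" where
  "orthonormal_basis E \<longleftrightarrow>
     (\<forall>e\<in>E. \<forall>e'\<in>E. cinner e e' = (if e = e' then 1 else 0)) \<and> closure (cL2.span E) = UNIV"

text \<open>
  The trace $\sum_{e \in E} \langle e, T e\rangle$, which for a trace-class operator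
  converges absolutely, to a value that does not depend on the orthonormal basis $E$.
  The result is unspecified if there is no such common value.
\<close>

definition op_trace :: "('a::euclidean_space L2 \<Rightarrow> 'a L2) \<Rightarrow> complex" where
  "op_trace T = (THE t. \<forall>E. orthonormal_basis E \<longrightarrow> ((\<lambda>e. cinner e (T e)) has_sum t) E)"

definition pure_state :: "'a::euclidean_space L2 \<Rightarrow> 'a L2 \<Rightarrow> 'a L2" where
  "pure_state u = (\<lambda>v. cinner u v *\<^sub>C u)"

text \<open>
  The exceptional null set may depend on the operator \<open>A\<close>.
\<close>

definition converges_as_WOT ::
  "'w measure \<Rightarrow> (nat \<Rightarrow> 'w \<Rightarrow> 'a::euclidean_space L2 \<Rightarrow> 'a L2) \<Rightarrow> ('a L2 \<Rightarrow> 'a L2) \<Rightarrow> bool" where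
  "converges_as_WOT M \<rho> \<rho>' \<longleftrightarrow>
     (\<forall>A\<in>bounded_operators.
        AE \<omega> in M. (\<lambda>n. op_trace (\<rho> n \<omega> \<circ> A)) \<longlonglongrightarrow> op_trace (\<rho>' \<circ> A))"

text \<open>
  The composition $S_{a_1/n} \cdots S_{a_n/n}$, with the factor $S_{a_n/n}$ applied first.
\<close>

definition shift_product :: "nat \<Rightarrow> (nat \<Rightarrow> 'a::euclidean_space) \<Rightarrow> 'a L2 \<Rightarrow> 'a L2" where
  "shift_product n a = foldr (\<lambda>k. shift_op (a k /\<^sub>R real n)) [1..<Suc n]"

end

theory Submission
  imports Defs
begin

text \<open>
  The product of shifts is the shift by the sample mean, which tends to \<open>\<mu>\<close> almost surely by the
  strong law of large numbers. Since \<open>a \<mapsto> S\<^sub>a u\<close> is norm continuous and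
  \<open>tr (\<rho>[v] A) = \<langle>v, A v\<rangle>\<close> is norm continuous in \<open>v\<close>, the claim follows.

  The strong law rests on the maximal ergodic inequality: if \<open>E X\<^sub>0 < 0\<close>, then the partial sums are
  almost surely bounded above, because by Kolmogorov's 0-1 law they would otherwise be almost surely
  unbounded above, and this would force \<open>E X\<^sub>0 \<ge> 0\<close>. Applying this to
  \<open>\<plusminus>(X\<^sub>k - E X\<^sub>0) - \<epsilon>\<close> gives the convergence of the averages.
\<close>

section \<open>The strong law of large numbers\<close>

text \<open>The maximum of the partial sums \<open>x 0 + ... + x (k - 1)\<close> for
  \<open>k \<le> n\<close>, the empty sum included. The recursion peels off the first term, so it
  relates the maximum for \<open>x\<close> to the one for the shifted sequence, as the maximal
  ergodic inequality requires.\<close>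

primrec max_sum :: "(nat \<Rightarrow> real) \<Rightarrow> nat \<Rightarrow> real" where
  "max_sum x 0 = 0"
| "max_sum x (Suc n) = max 0 (x 0 + max_sum (\<lambda>k. x (Suc k)) n)"

lemma
  shows max_sum_nonneg: "0 \<le> max_sum x n"
    and max_sum_le_Suc: "max_sum x n \<le> max_sum x (Suc n)"
proof (induction n arbitrary: x)
  case (Suc n)
  case 2
  show ?case
    unfolding max_sum.simps(2)[of x n] max_sum.simps(2)[of x "Suc n"]
    by (intro max.mono add_left_mono order_refl Suc.IH)
qed simp_all

lemma max_sum_mono: "m \<le> n \<Longrightarrow> max_sum x m \<le> max_sum x n"
  by (rule lift_Suc_mono_le) (rule max_sum_le_Suc)

lemma sum_le_max_sum: "(\<Sum>k<n. x k) \<le> max_sum x n"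
proof (induction n arbitrary: x)
  case (Suc n)
  show ?case
    using Suc.IH[of "\<lambda>k. x (Suc k)"] by (simp add: sum.lessThan_Suc_shift del: sum.lessThan_Suc)
qed simp

lemma borel_measurable_max_sum:
  assumes "\<And>k. X k \<in> borel_measurable M"
  shows "(\<lambda>\<omega>. max_sum (\<lambda>k. X k \<omega>) n) \<in> borel_measurable M"
  using assms by (induction n arbitrary: X) auto

lemma integrable_max_sum:
  assumes "\<And>k. integrable M (X k)"
  shows "integrable M (\<lambda>\<omega>. max_sum (\<lambda>k. X k \<omega>) n)"
  using assms by (induction n arbitrary: X) auto

text \<open>Dropping the first \<open>n\<close> terms changes every later partial sum by the same
  constant. Hence unboundedness depends only on the terms from \<open>n\<close> on, which makes it a
  tail event. The bound \<open>c\<close> ranges over naturals to keep the event a countable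
  combination.\<close>

lemma unbounded_sums_shift:
  fixes x :: "nat \<Rightarrow> real"
  shows "(\<forall>c::nat. \<exists>m. real c < (\<Sum>k<m. x k)) \<longleftrightarrow> (\<forall>c::nat. \<exists>m. real c < (\<Sum>k\<in>{n..<m}. x k))"
proof (intro iffI allI)
  fix c :: nat
  have split: "(\<Sum>k<m. x k) = (\<Sum>k<n. x k) + (\<Sum>k\<in>{n..<m}. x k)" if "n \<le> m" for m
    using sum.atLeastLessThan_concat[of 0 n m x] that by (simp add: atLeast0LessThan)
  {
    assume *: "\<forall>c::nat. \<exists>m. real c < (\<Sum>k<m. x k)"
    \<comment> \<open>The sum of absolute values dominates every partial sum of length at most
      \<open>n\<close>. A sum exceeding \<open>c'\<close> therefore has length
      \<open>m \<ge> n\<close>, and it still exceeds \<open>c\<close> after its first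
      \<open>n\<close> terms are removed.\<close>
    define c' where "c' = c + nat \<lceil>\<Sum>k<n. \<bar>x k\<bar>\<rceil>"
    have c': "real c + (\<Sum>k<n. \<bar>x k\<bar>) \<le> real c'"
      unfolding c'_def by (simp add: real_nat_ceiling_ge)
    obtain m where m: "real c' < (\<Sum>k<m. x k)" using * by blast
    have "n \<le> m"
    proof (rule ccontr)
      assume "\<not> n \<le> m"
      then have "(\<Sum>k<m. \<bar>x k\<bar>) \<le> (\<Sum>k<n. \<bar>x k\<bar>)" by (intro sum_mono2) auto
      with m c' sum_abs[of x "{..<m}"] show False by linarith
    qed
    then show "\<exists>m. real c < (\<Sum>k\<in>{n..<m}. x k)"
      using m c' split[of m] sum_abs[of x "{..<n}"] by (intro exI[of _ m]) linarith
  next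
    assume *: "\<forall>c::nat. \<exists>m. real c < (\<Sum>k\<in>{n..<m}. x k)"
    define c' where "c' = c + nat \<lceil>\<bar>\<Sum>k<n. x k\<bar>\<rceil>"
    have c': "real c + \<bar>\<Sum>k<n. x k\<bar> \<le> real c'"
      unfolding c'_def by (simp add: real_nat_ceiling_ge)
    obtain m where m: "real c' < (\<Sum>k\<in>{n..<m}. x k)" using * by blast
    have "n \<le> m" by (rule ccontr) (use m in simp)
    then show "\<exists>m. real c < (\<Sum>k<m. x k)"
      using m c' split[of m] by (intro exI[of _ m]) linarith
  }
qed

section \<open>Zero-one law for unbounded sums, stationarity, and the scalar strong law\<close>

context prob_space
begin

lemma prob_unbounded_sums_0_1:
  fixes X :: "nat \<Rightarrow> 'a \<Rightarrow> real"
  assumes indep: "indep_vars (\<lambda>_. borel) X UNIV"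
  defines "B \<equiv> {\<omega>\<in>space M. \<forall>c::nat. \<exists>m. real c < (\<Sum>k<m. X k \<omega>)}"
  shows "prob B = 0 \<or> prob B = 1"
proof (rule kolmogorov_0_1_law)
  define F where "F k = sigma_sets (space M) {X k -` A \<inter> space M |A. A \<in> sets borel}" for k
  show "sigma_algebra (space M) (F k)" for k
    unfolding F_def by (rule sigma_algebra_sigma_sets) auto
  show "indep_sets F UNIV"
    using indep unfolding indep_vars_def F_def by simp
  show "B \<in> tail_events F"
    unfolding tail_events_def
  proof
    fix n
    define N where "N = sigma (space M) (\<Union> (F ` {n..}))"
    have sub: "\<Union> (F ` {n..}) \<subseteq> Pow (space M)"
      using sigma_sets_into_sp[of "{X _ -` A \<inter> space M |A. A \<in> sets borel}" "space M"]
      unfolding F_def by blast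
    have space_N: "space N = space M" and sets_N: "sets N = sigma_sets (space M) (\<Union> (F ` {n..}))"
      unfolding N_def by (simp_all add: space_measure_of[OF sub] sets_measure_of[OF sub])
    have meas: "X k \<in> borel_measurable N" if "n \<le> k" for k
    proof (rule measurableI)
      fix A :: "real set" assume "A \<in> sets borel"
      then have "X k -` A \<inter> space M \<in> F k" unfolding F_def by blast
      then show "X k -` A \<inter> space N \<in> sets N"
        unfolding space_N sets_N using that by (intro sigma_sets.Basic) auto
    qed simp
    have [measurable]: "(\<lambda>\<omega>. \<Sum>k\<in>{n..<m}. X k \<omega>) \<in> borel_measurable N" for m
      by (intro borel_measurable_sum meas) simp
    have "{\<omega>\<in>space N. \<forall>c::nat. \<exists>m. real c < (\<Sum>k\<in>{n..<m}. X k \<omega>)} \<in> sets N"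
      by measurable
    then show "B \<in> sigma_sets (space M) (\<Union> (F ` {n..}))"
      unfolding B_def unbounded_sums_shift[where n = n] space_N sets_N .
  qed
qed

text \<open>Stationarity of an i.i.d. sequence: its law is an infinite product of copies of one
  measure \<open>D\<close>, and reindexing the coordinates by the injection \<open>Suc\<close>
  preserves this product.\<close>

lemma distr_sequence_shift:
  fixes X :: "nat \<Rightarrow> 'a \<Rightarrow> 'b"
  assumes indep: "indep_vars (\<lambda>_. N) X UNIV"
    and ident: "\<And>n. distr M N (X n) = distr M N (X 0)"
  shows "distr M (\<Pi>\<^sub>M k\<in>UNIV. N) (\<lambda>\<omega> k. X (Suc k) \<omega>) = distr M (\<Pi>\<^sub>M k\<in>UNIV. N) (\<lambda>\<omega> k. X k \<omega>)"
proof -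
  define D where "D = distr M N (X 0)"
  have rv: "random_variable N (X k)" for k
    using indep unfolding indep_vars_def by blast
  have sets_D: "sets D = sets N" unfolding D_def by simp
  interpret D: prob_space D unfolding D_def using rv by (rule prob_space_distr)
  have X: "distr M (\<Pi>\<^sub>M k\<in>UNIV. N) (\<lambda>\<omega> k. X k \<omega>) = (\<Pi>\<^sub>M k\<in>UNIV. D)"
    using indep_vars_iff_distr_eq_PiM[where I = UNIV and M' = "\<lambda>_. N" and X = X] indep rv
      ident[folded D_def] by (simp add: restrict_UNIV)
  \<comment> \<open>\<open>distr\<close> uses only the sigma-algebra of its target, so
    \<open>D\<close> and \<open>N\<close> are interchangeable there.\<close>
  have cong: "distr A (\<Pi>\<^sub>M k\<in>UNIV. D) f = distr A (\<Pi>\<^sub>M k\<in>UNIV. N) f" for A :: "'c measure" and f :: "'c \<Rightarrow> nat \<Rightarrow> 'b"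
    by (intro distr_cong sets_PiM_cong refl) (rule sets_D)
  have "(\<Pi>\<^sub>M k\<in>UNIV. D) = distr (\<Pi>\<^sub>M k\<in>UNIV. D) (\<Pi>\<^sub>M k\<in>UNIV. D) (\<lambda>x. \<lambda>k\<in>UNIV. x (Suc k))"
    by (rule distr_PiM_reindex[symmetric, of UNIV "\<lambda>_. D" Suc UNIV]) (auto intro: D.prob_space_axioms)
  also have "\<dots> = distr (distr M (\<Pi>\<^sub>M k\<in>UNIV. N) (\<lambda>\<omega> k. X k \<omega>)) (\<Pi>\<^sub>M k\<in>UNIV. N) (\<lambda>x k. x (Suc k))"
    unfolding cong X by (simp add: restrict_UNIV)
  also have "\<dots> = distr M (\<Pi>\<^sub>M k\<in>UNIV. N) (\<lambda>\<omega> k. X (Suc k) \<omega>)"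
  proof (subst distr_distr)
    show "(\<lambda>x k. x (Suc k)) \<in> measurable (\<Pi>\<^sub>M k\<in>UNIV. N) (\<Pi>\<^sub>M k\<in>UNIV. N)"
      by (intro measurable_PiM_single') (auto simp: space_PiM PiE_iff)
    show "(\<lambda>\<omega> k. X k \<omega>) \<in> measurable M (\<Pi>\<^sub>M k\<in>UNIV. N)"
      by (intro measurable_PiM_single') (auto simp: PiE_iff intro: rv measurable_space[OF rv])
  qed (simp add: comp_def)
  finally show ?thesis unfolding X ..
qed

lemma integrable_ident_distr:
  fixes X Y :: "'a \<Rightarrow> real"
  assumes [measurable]: "X \<in> borel_measurable M" "Y \<in> borel_measurable M"
    and "distr M borel X = distr M borel Y" "integrable M Y"
  shows "integrable M X"
proof -
  have "integrable (distr M borel X) (\<lambda>x. x)"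
    using assms by (simp add: integrable_distr_eq)
  then show ?thesis by (simp add: integrable_distr_eq)
qed

text \<open>If the sums were unbounded above with probability 1, then
  \<open>S (Suc n) - S' n = max (- S' n) (X 0)\<close> would eventually equal \<open>X 0\<close>. By
  stationarity these increments have nonnegative expectation, so dominated convergence would give
  \<open>0 \<le> expectation (X 0)\<close>. The zero-one law leaves only probability 0.\<close>

lemma AE_bounded_sums:
  fixes X :: "nat \<Rightarrow> 'a \<Rightarrow> real"
  assumes indep: "indep_vars (\<lambda>_. borel) X UNIV"
    and ident: "\<And>n. distr M borel (X n) = distr M borel (X 0)"
    and int: "integrable M (X 0)"
    and neg: "expectation (X 0) < 0"
  shows "AE \<omega> in M. \<exists>c::nat. \<forall>m. (\<Sum>k<m. X k \<omega>) \<le> real c"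
proof -
  have rv [measurable]: "random_variable borel (X k)" for k
    using indep unfolding indep_vars_def by blast
  have int_X: "integrable M (X k)" for k
    by (rule integrable_ident_distr[OF rv rv ident int])
  define B where "B = {\<omega>\<in>space M. \<forall>c::nat. \<exists>m. real c < (\<Sum>k<m. X k \<omega>)}"
  have [measurable]: "B \<in> events" unfolding B_def by measurable
  define S where "S n \<omega> = max_sum (\<lambda>k. X k \<omega>) n" for n \<omega>
  define S' where "S' n \<omega> = max_sum (\<lambda>k. X (Suc k) \<omega>) n" for n \<omega>
  have int_S: "integrable M (S n)" "integrable M (S' n)" for n
    unfolding S_def S'_def by (auto intro: integrable_max_sum int_X)
  have "expectation (S' n) = expectation (S n)" for n
  proof -
    have [measurable]: "(\<lambda>x. max_sum x n) \<in> borel_measurable (\<Pi>\<^sub>M k\<in>UNIV. borel)"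
      using borel_measurable_max_sum[of "\<lambda>k x. x k" "\<Pi>\<^sub>M k\<in>UNIV. borel" n] by simp
    have [measurable]: "(\<lambda>\<omega> k. X (f k) \<omega>) \<in> measurable M (\<Pi>\<^sub>M k\<in>UNIV. borel)" for f :: "nat \<Rightarrow> nat"
      by (intro measurable_PiM_single') auto
    have "expectation (S' n) = integral\<^sup>L (distr M (\<Pi>\<^sub>M k\<in>UNIV. borel) (\<lambda>\<omega> k. X (Suc k) \<omega>)) (\<lambda>x. max_sum x n)"
      unfolding S'_def by (simp add: integral_distr)
    also have "\<dots> = expectation (S n)"
      unfolding S_def by (subst distr_sequence_shift[OF indep ident]) (simp add: integral_distr)
    finally show ?thesis .
  qed
  \<comment> \<open>\<open>S' n\<close> has the same expectation as \<open>S n\<close>, and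
    \<open>S n \<le> S (Suc n)\<close> pointwise.\<close>
  then have increment_nonneg: "0 \<le> expectation (\<lambda>\<omega>. S (Suc n) \<omega> - S' n \<omega>)" for n
    using integral_mono[OF int_S(1)[of n] int_S(1)[of "Suc n"]] max_sum_le_Suc[of _ n]
    by (simp add: S_def[abs_def] int_S[unfolded S_def] del: max_sum.simps)
  have increment_lim: "(\<lambda>n. expectation (\<lambda>\<omega>. S (Suc n) \<omega> - S' n \<omega>)) \<longlonglongrightarrow> expectation (X 0)" if "prob B = 1"
  proof (rule integral_dominated_convergence)
    show "integrable M (\<lambda>\<omega>. \<bar>X 0 \<omega>\<bar>)" using int by simp
    show "AE \<omega> in M. (\<lambda>n. S (Suc n) \<omega> - S' n \<omega>) \<longlonglongrightarrow> X 0 \<omega>"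
    proof -
      have "AE \<omega> in M. \<omega> \<in> B" using that by (rule AE_prob_1)
      then show ?thesis
      proof eventually_elim
        case (elim \<omega>)
        \<comment> \<open>One positive partial sum suffices: if its length is \<open>Suc l\<close>,
          then \<open>X 0 + S' n > 0\<close> for all \<open>n \<ge> l\<close>, and the maximum with
          0 in the recursion is inactive.\<close>
        then obtain m where m: "0 < (\<Sum>k<m. X k \<omega>)" unfolding B_def by (auto dest: spec[of _ 0])
        then obtain l where l: "m = Suc l" by (cases m) auto
        have "S (Suc n) \<omega> - S' n \<omega> = X 0 \<omega>" if "l \<le> n" for n
          using m sum_le_max_sum[of "\<lambda>k. X (Suc k) \<omega>" l] max_sum_mono[OF that, of "\<lambda>k. X (Suc k) \<omega>"]
          unfolding l by (simp add: sum.lessThan_Suc_shift S_def S'_def del: sum.lessThan_Suc)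
        then show ?case
          by (intro tendsto_eventually eventually_sequentiallyI)
      qed
    qed
    show "AE \<omega> in M. norm (S (Suc n) \<omega> - S' n \<omega>) \<le> \<bar>X 0 \<omega>\<bar>" for n
    proof (rule AE_I2)
      fix \<omega>
      show "norm (S (Suc n) \<omega> - S' n \<omega>) \<le> \<bar>X 0 \<omega>\<bar>"
        \<comment> \<open>Since \<open>S' n \<ge> 0\<close>, the increment equals \<open>X 0\<close>
          where \<open>X 0 \<ge> 0\<close> and lies between \<open>X 0\<close> and 0
          elsewhere.\<close>
        using max_sum_nonneg[of "\<lambda>k. X (Suc k) \<omega>" n] by (simp add: S_def S'_def)
    qed
    show "X 0 \<in> borel_measurable M" by (rule rv)
    show "(\<lambda>\<omega>. S (Suc n) \<omega> - S' n \<omega>) \<in> borel_measurable M" for n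
      by (intro borel_measurable_integrable Bochner_Integration.integrable_diff int_S)
  qed
  have "prob B \<noteq> 1"
  proof
    assume "prob B = 1"
    then have "0 \<le> expectation (X 0)"
      by (intro LIMSEQ_le_const[OF increment_lim] exI allI impI increment_nonneg)
    with neg show False by simp
  qed
  with prob_unbounded_sums_0_1[OF indep] have "prob B = 0" unfolding B_def by blast
  then have "AE \<omega> in M. \<omega> \<notin> B" by (simp add: prob_eq_0)
  then show ?thesis
    using AE_space by eventually_elim (auto simp: B_def not_less)
qed

text \<open>Subtracting slightly more than the mean makes the expectation negative, so the resulting
  sums are bounded by some \<open>c\<close>, and \<open>c / n\<close> vanishes in the limit.\<close>

lemma AE_limsup_average_le:
  fixes X :: "nat \<Rightarrow> 'a \<Rightarrow> real"
  assumes indep: "indep_vars (\<lambda>_. borel) X UNIV"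
    and ident: "\<And>n. distr M borel (X n) = distr M borel (X 0)"
    and int: "integrable M (X 0)"
  shows "AE \<omega> in M. \<forall>e>0. \<forall>\<^sub>F n in sequentially. (\<Sum>k<n. X k \<omega>) / n < expectation (X 0) + e"
proof -
  have rv [measurable]: "random_variable borel (X k)" for k
    using indep unfolding indep_vars_def by blast
  define m where "m = expectation (X 0)"
  have "AE \<omega> in M. \<exists>c::nat. \<forall>n. (\<Sum>k<n. X k \<omega> - (m + 1 / Suc j)) \<le> c" for j
  proof (rule AE_bounded_sums)
    show "indep_vars (\<lambda>_. borel) (\<lambda>k \<omega>. X k \<omega> - (m + 1 / Suc j)) UNIV"
      using indep by (rule indep_vars_compose2[where Y = "\<lambda>_ x. x - (m + 1 / Suc j)"]) simp
    have "distr M borel (\<lambda>\<omega>. X n \<omega> - (m + 1 / Suc j)) = distr (distr M borel (X n)) borel (\<lambda>x. x - (m + 1 / Suc j))" for n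
      by (subst distr_distr) (auto simp: comp_def)
    then show "distr M borel (\<lambda>\<omega>. X n \<omega> - (m + 1 / Suc j)) = distr M borel (\<lambda>\<omega>. X 0 \<omega> - (m + 1 / Suc j))" for n
      using ident[of n] by simp
  qed (use int in \<open>simp_all add: m_def prob_space\<close>)
  \<comment> \<open>The slacks \<open>1 / Suc j\<close> form a countable family, so one null set
    serves all \<open>e > 0\<close>.\<close>
  then have "AE \<omega> in M. \<forall>j. \<exists>c::nat. \<forall>n. (\<Sum>k<n. X k \<omega> - (m + 1 / Suc j)) \<le> c"
    by (subst AE_all_countable) blast
  then show ?thesis
  proof eventually_elim
    case (elim \<omega>)
    show ?case
    proof (intro allI impI)
      fix e :: real assume "e > 0"
      then obtain j where j: "1 / Suc j < e / 2"
        using reals_Archimedean[of "e/2"] by (auto simp: inverse_eq_divide)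
      obtain c :: nat where c: "(\<Sum>k<n. X k \<omega> - (m + 1 / Suc j)) \<le> c" for n
        using elim by blast
      have "((\<lambda>n. real c / real n) \<longlonglongrightarrow> 0)" by (rule lim_const_over_n)
      then have "\<forall>\<^sub>F n in sequentially. c / real n < e / 2"
        by (rule order_tendstoD) (use \<open>e > 0\<close> in simp)
      then show "\<forall>\<^sub>F n in sequentially. (\<Sum>k<n. X k \<omega>) / n < expectation (X 0) + e"
        using eventually_gt_at_top[of 0]
      proof eventually_elim
        case (elim n)
        have "(\<Sum>k<n. X k \<omega>) \<le> c + n * (m + 1 / Suc j)"
          using c[of n] by (simp add: sum_subtractf)
        then have "(\<Sum>k<n. X k \<omega>) / n \<le> (c + n * (m + 1 / Suc j)) / n"
          by (rule divide_right_mono) simp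
        also have "\<dots> = c / n + (m + 1 / Suc j)" using \<open>0 < n\<close> by (simp add: add_divide_distrib)
        also have "\<dots> < m + e" using j elim(1) by linarith
        finally show ?case unfolding m_def .
      qed
    qed
  qed
qed

text \<open>The upper bound for \<open>X\<close> and the one for \<open>- X\<close> enclose the
  averages from both sides.\<close>

theorem strong_law_of_large_numbers_real:
  fixes X :: "nat \<Rightarrow> 'a \<Rightarrow> real"
  assumes indep: "indep_vars (\<lambda>_. borel) X UNIV"
    and ident: "\<And>n. distr M borel (X n) = distr M borel (X 0)"
    and int: "integrable M (X 0)"
  shows "AE \<omega> in M. (\<lambda>n. (\<Sum>k<n. X k \<omega>) / n) \<longlonglongrightarrow> expectation (X 0)"
proof -
  have rv [measurable]: "random_variable borel (X k)" for k
    using indep unfolding indep_vars_def by blast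
  have "AE \<omega> in M. \<forall>e>0. \<forall>\<^sub>F n in sequentially. (\<Sum>k<n. - X k \<omega>) / n < expectation (\<lambda>\<omega>. - X 0 \<omega>) + e"
  proof (rule AE_limsup_average_le)
    show "indep_vars (\<lambda>_. borel) (\<lambda>k \<omega>. - X k \<omega>) UNIV"
      using indep by (rule indep_vars_compose2[where Y = "\<lambda>_ x. - x"]) simp
    have "distr M borel (\<lambda>\<omega>. - X n \<omega>) = distr (distr M borel (X n)) borel uminus" for n
      by (subst distr_distr) (auto simp: comp_def)
    then show "distr M borel (\<lambda>\<omega>. - X n \<omega>) = distr M borel (\<lambda>\<omega>. - X 0 \<omega>)" for n
      using ident[of n] by simp
  qed (use int in simp)
  with AE_limsup_average_le[OF assms] show ?thesis
  proof eventually_elim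
    case (elim \<omega>)
    show ?case
    proof (rule tendstoI)
      fix e :: real assume "e > 0"
      with elim have "\<forall>\<^sub>F n in sequentially. (\<Sum>k<n. X k \<omega>) / n < expectation (X 0) + e"
        "\<forall>\<^sub>F n in sequentially. (\<Sum>k<n. - X k \<omega>) / n < expectation (\<lambda>\<omega>. - X 0 \<omega>) + e" by blast+
      then show "\<forall>\<^sub>F n in sequentially. dist ((\<Sum>k<n. X k \<omega>) / n) (expectation (X 0)) < e"
        by eventually_elim (auto simp: dist_real_def sum_negf abs_if)
    qed
  qed
qed

end

text \<open>Reduces to the scalar law in each coordinate; the basis is finite, so the null sets
  combine.\<close>

theorem strong_law_of_large_numbers:
  fixes X :: "nat \<Rightarrow> 'w \<Rightarrow> 'a::euclidean_space"
  assumes "prob_space M"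
    and indep: "prob_space.indep_vars M (\<lambda>_. borel) X UNIV"
    and ident: "\<And>n. distr M borel (X n) = distr M borel (X 0)"
    and int: "integrable M (X 0)"
  shows "AE \<omega> in M. (\<lambda>n. (\<Sum>k<n. X k \<omega>) /\<^sub>R real n) \<longlonglongrightarrow> integral\<^sup>L M (X 0)"
proof -
  interpret prob_space M by fact
  have rv [measurable]: "random_variable borel (X k)" for k
    using indep unfolding indep_vars_def by blast
  have "AE \<omega> in M. (\<lambda>n. (\<Sum>k<n. X k \<omega> \<bullet> b) / real n) \<longlonglongrightarrow> expectation (\<lambda>\<omega>. X 0 \<omega> \<bullet> b)" for b
  proof (rule strong_law_of_large_numbers_real)
    show "indep_vars (\<lambda>_. borel) (\<lambda>k \<omega>. X k \<omega> \<bullet> b) UNIV"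
      using indep by (rule indep_vars_compose2[where Y = "\<lambda>_ x. x \<bullet> b"]) simp
    have "distr M borel (\<lambda>\<omega>. X n \<omega> \<bullet> b) = distr (distr M borel (X n)) borel (\<lambda>x. x \<bullet> b)" for n
      by (subst distr_distr) (auto simp: comp_def)
    then show "distr M borel (\<lambda>\<omega>. X n \<omega> \<bullet> b) = distr M borel (\<lambda>\<omega>. X 0 \<omega> \<bullet> b)" for n
      using ident[of n] by simp
  qed (use int in simp)
  then have "AE \<omega> in M. \<forall>b\<in>Basis. (\<lambda>n. (\<Sum>k<n. X k \<omega> \<bullet> b) / real n) \<longlonglongrightarrow> expectation (\<lambda>\<omega>. X 0 \<omega> \<bullet> b)"
    by (subst AE_finite_all) auto
  then show ?thesis
  proof eventually_elim
    case (elim \<omega>)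
    have "(\<lambda>n. ((\<Sum>k<n. X k \<omega>) /\<^sub>R real n) \<bullet> b) \<longlonglongrightarrow> integral\<^sup>L M (X 0) \<bullet> b" if "b \<in> Basis" for b
    proof -
      have "integral\<^sup>L M (X 0) \<bullet> b = expectation (\<lambda>\<omega>. X 0 \<omega> \<bullet> b)"
        using int by (rule integral_inner_left[symmetric])
      then show ?thesis
        using elim that by (simp add: inner_sum_left divide_inverse mult.commute)
    qed
    then show ?case by (subst tendsto_componentwise_iff) blast
  qed
qed

text \<open>Serves to renumber a family indexed from 1 as one indexed from 0.\<close>

lemma (in prob_space) indep_vars_reindex:
  assumes indep: "indep_vars N X (f ` I)" and inj: "inj_on f I"
  shows "indep_vars (\<lambda>i. N (f i)) (\<lambda>i. X (f i)) I"
  unfolding indep_vars_def2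
proof (intro conjI ballI indep_setsI)
  show "random_variable (N (f i)) (X (f i))" if "i \<in> I" for i
    using indep that unfolding indep_vars_def2 by blast
  then show "{X (f i) -` A \<inter> space M |A. A \<in> sets (N (f i))} \<subseteq> events" if "i \<in> I" for i
    using that by (auto intro: measurable_sets)
next
  fix A J
  assume J: "J \<noteq> {}" "J \<subseteq> I" "finite J"
    and A: "\<forall>j\<in>J. A j \<in> {X (f j) -` A \<inter> space M |A. A \<in> sets (N (f j))}"
  have inj_J: "inj_on f J" using inj J(2) by (rule inj_on_subset)
  note inv [simp] = the_inv_into_f_f[OF inj_J]
  have "prob (\<Inter>j\<in>f ` J. A (the_inv_into J f j)) = (\<Prod>j\<in>f ` J. prob (A (the_inv_into J f j)))"
  proof (rule indep_setsD)
    show "indep_sets (\<lambda>i. {X i -` A \<inter> space M |A. A \<in> sets (N i)}) (f ` I)"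
      using indep unfolding indep_vars_def2 by blast
  qed (use A J in auto)
  then show "prob (\<Inter>j\<in>J. A j) = (\<Prod>j\<in>J. prob (A j))"
    by (simp add: prod.reindex[OF inj_J])
qed

section \<open>Strong continuity of the shifts\<close>

lemma
  fixes f :: "'a::euclidean_space \<Rightarrow> 'b::{banach, second_countable_topology}"
  assumes "integrable lborel f"
  shows integrable_lborel_shift: "integrable lborel (\<lambda>x. f (x + a))"
    and integral_lborel_shift: "(\<integral>x. f (x + a) \<partial>lborel) = (\<integral>x. f x \<partial>lborel)"
proof -
  have [measurable]: "f \<in> borel_measurable borel"
    using borel_measurable_integrable[OF assms] by simp
  have "integrable (distr lborel borel ((+) a)) f"
    using assms by (simp add: lborel_distr_plus)
  then show "integrable lborel (\<lambda>x. f (x + a))"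
    by (simp add: integrable_distr_eq add.commute)
  have "(\<integral>x. f x \<partial>lborel) = (\<integral>x. f x \<partial>distr lborel borel ((+) a))"
    by (simp add: lborel_distr_plus)
  then show "(\<integral>x. f (x + a) \<partial>lborel) = (\<integral>x. f x \<partial>lborel)"
    by (simp add: integral_distr add.commute)
qed

text \<open>Translations are isometries of $L_1$, so the functions with the desired continuity along
  \<open>a\<close> form a closed set: a three-epsilon argument.\<close>

lemma L1_shift_approx:
  fixes f :: "'a::euclidean_space \<Rightarrow> real"
  assumes f: "integrable lborel f"
    and approx: "\<And>e. e > 0 \<Longrightarrow> \<exists>g. integrable lborel g \<and> (\<integral>x. \<bar>f x - g x\<bar> \<partial>lborel) < e
      \<and> (\<lambda>n. \<integral>x. \<bar>g (x + a n) - g x\<bar> \<partial>lborel) \<longlonglongrightarrow> 0"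
  shows "(\<lambda>n. \<integral>x. \<bar>f (x + a n) - f x\<bar> \<partial>lborel) \<longlonglongrightarrow> 0"
proof (rule tendstoI)
  fix e :: real assume "e > 0"
  then obtain g where g: "integrable lborel g" "(\<integral>x. \<bar>f x - g x\<bar> \<partial>lborel) < e / 3"
    "(\<lambda>n. \<integral>x. \<bar>g (x + a n) - g x\<bar> \<partial>lborel) \<longlonglongrightarrow> 0"
    using approx[of "e / 3"] by auto
  have "\<forall>\<^sub>F n in sequentially. (\<integral>x. \<bar>g (x + a n) - g x\<bar> \<partial>lborel) < e / 3"
    by (rule order_tendstoD(2)[OF g(3)]) (use \<open>e > 0\<close> in simp)
  then show "\<forall>\<^sub>F n in sequentially. dist (\<integral>x. \<bar>f (x + a n) - f x\<bar> \<partial>lborel) 0 < e"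
  proof eventually_elim
    case (elim n)
    note int [simp, intro] = f g(1) f[THEN integrable_lborel_shift] g(1)[THEN integrable_lborel_shift]
    have fg: "integrable lborel (\<lambda>x. \<bar>f x - g x\<bar>)" by simp
    have "(\<integral>x. \<bar>f (x + a n) - f x\<bar> \<partial>lborel)
        \<le> (\<integral>x. \<bar>f (x + a n) - g (x + a n)\<bar> + \<bar>g (x + a n) - g x\<bar> + \<bar>f x - g x\<bar> \<partial>lborel)"
      by (rule integral_mono) auto
    also have "\<dots> = (\<integral>x. \<bar>f (x + a n) - g (x + a n)\<bar> \<partial>lborel)
        + (\<integral>x. \<bar>g (x + a n) - g x\<bar> \<partial>lborel) + (\<integral>x. \<bar>f x - g x\<bar> \<partial>lborel)"
      by simp
    also have "(\<integral>x. \<bar>f (x + a n) - g (x + a n)\<bar> \<partial>lborel) = (\<integral>x. \<bar>f x - g x\<bar> \<partial>lborel)"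
      by (rule integral_lborel_shift[OF fg])
    finally have "(\<integral>x. \<bar>f (x + a n) - f x\<bar> \<partial>lborel) < e"
      using elim g(2) by linarith
    then show ?case by simp
  qed
qed

text \<open>A point of an open set stays inside under small translations, which gives pointwise
  convergence on \<open>U\<close>. The identity \<open>\<bar>s - t\<bar> = s + t - 2 * s * t\<close>
  for values 0 and 1 turns the integral into one of the product of the indicators.\<close>

lemma L1_shift_open:
  fixes U :: "'a::euclidean_space set"
  assumes U: "open U" "emeasure lborel U < \<infinity>" and a: "a \<longlonglongrightarrow> 0"
  shows "(\<lambda>n. \<integral>x. \<bar>indicator U (x + a n) - indicator U x\<bar> \<partial>lborel :: real) \<longlonglongrightarrow> 0"
proof -
  let ?I = "indicator U :: 'a \<Rightarrow> real"
  have [measurable]: "U \<in> sets borel" using U by simp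
  have int: "integrable lborel ?I"
    using U by simp
  note int' = integrable_lborel_shift[OF int]
  have int_prod: "integrable lborel (\<lambda>x. ?I x * ?I (x + b))" for b
    by (rule Bochner_Integration.integrable_bound[OF int]) (auto split: split_indicator)
  \<comment> \<open>The factor \<open>?I x\<close> removes the points outside \<open>U\<close>,
    including boundary points, where \<open>?I (x + a n)\<close> may fail to converge.\<close>
  have "(\<lambda>n. \<integral>x. ?I x * ?I (x + a n) \<partial>lborel) \<longlonglongrightarrow> (\<integral>x. ?I x \<partial>lborel)"
  proof (rule integral_dominated_convergence[OF _ _ int])
    show "AE x in lborel. (\<lambda>n. ?I x * ?I (x + a n)) \<longlonglongrightarrow> ?I x"
    proof (rule AE_I2)
      fix x
      have "(\<lambda>n. x + a n) \<longlonglongrightarrow> x" using tendsto_add[OF tendsto_const a] by simp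
      then have "\<forall>\<^sub>F n in sequentially. x + a n \<in> U" if "x \<in> U"
        using topological_tendstoD U(1) that by blast
      then show "(\<lambda>n. ?I x * ?I (x + a n)) \<longlonglongrightarrow> ?I x"
        by (cases "x \<in> U") (auto intro!: tendsto_eventually elim!: eventually_mono)
    qed
  qed (auto split: split_indicator)
  then have "(\<lambda>n. 2 * (\<integral>x. ?I x \<partial>lborel) - 2 * (\<integral>x. ?I x * ?I (x + a n) \<partial>lborel)) \<longlonglongrightarrow> 0"
    by (auto intro!: tendsto_eq_intros)
  moreover have "(\<integral>x. \<bar>?I (x + b) - ?I x\<bar> \<partial>lborel)
      = 2 * (\<integral>x. ?I x \<partial>lborel) - 2 * (\<integral>x. ?I x * ?I (x + b) \<partial>lborel)" for b
  proof -
    have "(\<integral>x. \<bar>?I (x + b) - ?I x\<bar> \<partial>lborel)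
        = (\<integral>x. ?I (x + b) + ?I x - 2 * (?I x * ?I (x + b)) \<partial>lborel)"
      by (intro Bochner_Integration.integral_cong refl) (auto split: split_indicator)
    also have "\<dots> = (\<integral>x. ?I (x + b) \<partial>lborel) + (\<integral>x. ?I x \<partial>lborel) - (\<integral>x. 2 * (?I x * ?I (x + b)) \<partial>lborel)"
      by (simp only: Bochner_Integration.integral_diff Bochner_Integration.integral_add
          Bochner_Integration.integrable_add integrable_mult_right int int' int_prod)
    finally show ?thesis using integral_lborel_shift[OF int, of b] by simp
  qed
  ultimately show ?thesis by simp
qed

text \<open>Induction over integrable functions: indicators are approximated in $L_1$ by indicators
  of open sets, and the closure property above also handles dominated limits.\<close>

lemma L1_shift_continuous:
  fixes f :: "'a::euclidean_space \<Rightarrow> real"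
  assumes "integrable lborel f" and a: "a \<longlonglongrightarrow> 0"
  shows "(\<lambda>n. \<integral>x. \<bar>f (x + a n) - f x\<bar> \<partial>lborel) \<longlonglongrightarrow> 0"
  using assms(1)
proof (induction f rule: integrable_induct)
  case (base A c)
  have [measurable]: "A \<in> sets borel" using base by simp
  have int_A: "integrable lborel (indicator A :: 'a \<Rightarrow> real)" using base by simp
  have "(\<lambda>n. \<integral>x. \<bar>indicator A (x + a n) - indicator A x\<bar> \<partial>lborel :: real) \<longlonglongrightarrow> 0"
  proof (rule L1_shift_approx[OF int_A])
    fix e :: real assume "e > 0"
    obtain U where U: "open U" "A \<subseteq> U" "emeasure lborel (U - A) < ennreal e"
      using outer_regular_lborel[OF \<open>A \<in> sets borel\<close> \<open>e > 0\<close>] .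
    have [measurable]: "U \<in> sets borel" using U by simp
    \<comment> \<open>Finiteness of the measure of \<open>U\<close> makes its indicator
      integrable.\<close>
    have "emeasure lborel U \<le> emeasure lborel A + emeasure lborel (U - A)"
      using U(2) by (subst emeasure_Un[symmetric] plus_emeasure) (auto simp: Un_absorb1)
    also have "\<dots> < \<infinity>" using base U(3) by (auto simp: less_top[symmetric] top_unique)
    finally have fin: "emeasure lborel U < \<infinity>" .
    have "(\<integral>x. \<bar>indicator A x - indicator U x\<bar> \<partial>lborel :: real) = (\<integral>x. indicator (U - A) x \<partial>lborel)"
      using U(2) by (intro Bochner_Integration.integral_cong refl) (auto split: split_indicator)
    also have "\<dots> < e"
    proof -
      have "emeasure lborel (U - A) = ennreal (measure lborel (U - A))"
        using U(3) by (intro emeasure_eq_ennreal_measure) auto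
      then show ?thesis using U(3) by (simp add: ennreal_less_iff)
    qed
    finally show "\<exists>g. integrable lborel g \<and> (\<integral>x. \<bar>indicator A x - g x\<bar> \<partial>lborel) < e
      \<and> (\<lambda>n. \<integral>x. \<bar>g (x + a n) - g x\<bar> \<partial>lborel) \<longlonglongrightarrow> 0"
      using L1_shift_open[OF U(1) fin a] fin by (intro exI[of _ "indicator U"]) simp
  qed
  then have "(\<lambda>n. (\<integral>x. \<bar>indicator A (x + a n) - indicator A x\<bar> \<partial>lborel) * \<bar>c\<bar>) \<longlonglongrightarrow> 0"
    by (rule tendsto_mult_left_zero)
  then show ?case
    by (simp add: left_diff_distrib[symmetric] abs_mult)
next
  case (add f g)
  note int [simp, intro] = add.hyps add.hyps[THEN integrable_lborel_shift]
  have *: "(\<lambda>n. (\<integral>x. \<bar>f (x + a n) - f x\<bar> \<partial>lborel) + (\<integral>x. \<bar>g (x + a n) - g x\<bar> \<partial>lborel)) \<longlonglongrightarrow> 0"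
    using tendsto_add[OF add.IH] by simp
  show ?case
  proof (rule tendsto_sandwich[OF _ _ tendsto_const *])
    have "(\<integral>x. \<bar>f (x + b) + g (x + b) - (f x + g x)\<bar> \<partial>lborel)
        \<le> (\<integral>x. \<bar>f (x + b) - f x\<bar> + \<bar>g (x + b) - g x\<bar> \<partial>lborel)" for b
      by (rule integral_mono) auto
    then show "\<forall>\<^sub>F n in sequentially. (\<integral>x. \<bar>f (x + a n) + g (x + a n) - (f x + g x)\<bar> \<partial>lborel)
        \<le> (\<integral>x. \<bar>f (x + a n) - f x\<bar> \<partial>lborel) + (\<integral>x. \<bar>g (x + a n) - g x\<bar> \<partial>lborel)"
      by simp
  qed simp
next
  case (lim f s)
  have [measurable]: "f \<in> borel_measurable borel" "s i \<in> borel_measurable borel" for i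
    using lim.hyps borel_measurable_integrable[of lborel] by auto
  have "(\<lambda>i. \<integral>x. \<bar>f x - s i x\<bar> \<partial>lborel) \<longlonglongrightarrow> (\<integral>x. 0 \<partial>(lborel :: 'a measure))"
  proof (rule integral_dominated_convergence)
    \<comment> \<open>The induction rule supplies approximants bounded by twice the norm of
      \<open>f\<close>; the triangle inequality adds one more.\<close>
    show "integrable lborel (\<lambda>x. 3 * \<bar>f x\<bar>)" using lim.hyps by simp
    show "AE x in lborel. norm \<bar>f x - s i x\<bar> \<le> 3 * \<bar>f x\<bar>" for i
    proof (rule AE_I2)
      fix x
      have "norm (s i x) \<le> 2 * norm (f x)" by (rule lim.hyps(3)) simp
      then show "norm \<bar>f x - s i x\<bar> \<le> 3 * \<bar>f x\<bar>" by simp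
    qed
    show "AE x in lborel. (\<lambda>i. \<bar>f x - s i x\<bar>) \<longlonglongrightarrow> 0"
      using lim.hyps(2) by (intro AE_I2 tendsto_rabs_zero) (auto intro!: tendsto_eq_intros)
  qed auto
  then have L1: "(\<lambda>i. \<integral>x. \<bar>f x - s i x\<bar> \<partial>lborel) \<longlonglongrightarrow> 0" by simp
  show ?case
  proof (rule L1_shift_approx[OF lim.hyps(4)])
    fix e :: real assume "e > 0"
    then obtain i where "(\<integral>x. \<bar>f x - s i x\<bar> \<partial>lborel) < e"
      using order_tendstoD(2)[OF L1] eventually_happens'[OF sequentially_bot] by blast
    then show "\<exists>g. integrable lborel g \<and> (\<integral>x. \<bar>f x - g x\<bar> \<partial>lborel) < e
        \<and> (\<lambda>n. \<integral>x. \<bar>g (x + a n) - g x\<bar> \<partial>lborel) \<longlonglongrightarrow> 0"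
      using lim.hyps(1) lim.IH by blast
  qed
qed

text \<open>For nonnegative functions, \<open>(s - t)\<^sup>2 \<le> \<bar>s\<^sup>2 - t\<^sup>2\<bar>\<close> reduces the claim to continuity in $L_1$.\<close>

lemma L2_shift_continuous_nonneg:
  fixes p :: "'a::euclidean_space \<Rightarrow> real"
  assumes [measurable]: "p \<in> borel_measurable borel"
    and nonneg: "\<And>x. 0 \<le> p x" and int: "integrable lborel (\<lambda>x. (p x)\<^sup>2)" and a: "a \<longlonglongrightarrow> 0"
  shows "integrable lborel (\<lambda>x. (p (x + b) - p x)\<^sup>2)"
    and "(\<lambda>n. \<integral>x. (p (x + a n) - p x)\<^sup>2 \<partial>lborel) \<longlonglongrightarrow> 0"
proof -
  have le: "(s - t)\<^sup>2 \<le> \<bar>s\<^sup>2 - t\<^sup>2\<bar>" if "0 \<le> s" "0 \<le> t" for s t :: real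
  proof -
    have "(s - t)\<^sup>2 = \<bar>s - t\<bar> * \<bar>s - t\<bar>" by (simp add: power2_eq_square)
    also have "\<dots> \<le> \<bar>s - t\<bar> * \<bar>s + t\<bar>" using that by (intro mult_left_mono) auto
    also have "\<dots> = \<bar>s\<^sup>2 - t\<^sup>2\<bar>" by (simp add: abs_mult[symmetric] power2_eq_square algebra_simps)
    finally show ?thesis .
  qed
  have int': "integrable lborel (\<lambda>x. \<bar>(p (x + b))\<^sup>2 - (p x)\<^sup>2\<bar>)" for b
    using int integrable_lborel_shift[OF int] by auto
  show int_diff: "integrable lborel (\<lambda>x. (p (x + b) - p x)\<^sup>2)" for b
    by (rule Bochner_Integration.integrable_bound[OF int'[of b]]) (auto intro!: le nonneg)
  show "(\<lambda>n. \<integral>x. (p (x + a n) - p x)\<^sup>2 \<partial>lborel) \<longlonglongrightarrow> 0"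
  proof (rule tendsto_sandwich[OF _ _ tendsto_const L1_shift_continuous[OF int a]])
    show "\<forall>\<^sub>F n in sequentially. (\<integral>x. (p (x + a n) - p x)\<^sup>2 \<partial>lborel)
        \<le> (\<integral>x. \<bar>(p (x + a n))\<^sup>2 - (p x)\<^sup>2\<bar> \<partial>lborel)"
      by (intro always_eventually allI integral_mono int_diff int' le nonneg)
  qed simp
qed

text \<open>The function splits into the positive and negative parts of its real and imaginary
  parts, and the nonnegative case applies to each of the four.\<close>

lemma L2_shift_continuous:
  fixes f :: "'a::euclidean_space \<Rightarrow> complex"
  assumes f: "square_integrable f" and a: "a \<longlonglongrightarrow> 0"
  shows "(\<lambda>n. \<integral>x. (cmod (f (x + a n) - f x))\<^sup>2 \<partial>lborel) \<longlonglongrightarrow> 0"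
proof -
  have [measurable]: "f \<in> borel_measurable borel"
    using square_integrable_measurable[OF f] by simp
  have int: "integrable lborel (\<lambda>x. (cmod (f x))\<^sup>2)"
    using f unfolding square_integrable_def by blast
  \<comment> \<open>Indexing the four parts by \<open>j\<close> lets their common properties be
    proved at once.\<close>
  define p :: "nat \<Rightarrow> 'a \<Rightarrow> real" where
    "p = (\<lambda>j x. [max 0 (Re (f x)), max 0 (- Re (f x)), max 0 (Im (f x)), max 0 (- Im (f x))] ! j)"
  have p: "p 0 x = max 0 (Re (f x))" "p 1 x = max 0 (- Re (f x))"
    "p 2 x = max 0 (Im (f x))" "p 3 x = max 0 (- Im (f x))" for x
    unfolding p_def by (simp_all add: numeral_eq_Suc)
  have meas: "p j \<in> borel_measurable borel" and nonneg: "0 \<le> p j x" and le: "p j x \<le> cmod (f x)"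
    if "j \<in> {0, 1, 2, 3}" for j x
  proof -
    have "p 0 \<in> borel_measurable borel" "p 1 \<in> borel_measurable borel"
      "p 2 \<in> borel_measurable borel" "p 3 \<in> borel_measurable borel"
      by (subst p[abs_def], measurable)+
    then show "p j \<in> borel_measurable borel" using that by auto
    show "0 \<le> p j x" using that by (auto simp: p simp del: One_nat_def)
    show "p j x \<le> cmod (f x)"
      using that abs_Re_le_cmod[of "f x"] abs_Im_le_cmod[of "f x"]
      by (auto simp: p simp del: One_nat_def)
  qed
  have int_p: "integrable lborel (\<lambda>x. (p j x)\<^sup>2)" if "j \<in> {0, 1, 2, 3}" for j
  proof (rule Bochner_Integration.integrable_bound[OF int])
    show "(\<lambda>x. (p j x)\<^sup>2) \<in> borel_measurable lborel" using meas[OF that] by simp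
    show "AE x in lborel. norm ((p j x)\<^sup>2) \<le> norm ((cmod (f x))\<^sup>2)"
      using nonneg[OF that] le[OF that] by (intro AE_I2) (auto intro!: power_mono)
  qed
  note p_shift = L2_shift_continuous_nonneg[OF meas nonneg int_p a]
  \<comment> \<open>Real and imaginary parts are differences of two entries of \<open>p\<close>; the
    factor 2 comes from \<open>sq\<close>.\<close>
  have "(cmod (f y - f x))\<^sup>2 \<le> 2 * (\<Sum>j\<in>{0, 1, 2, 3}. (p j y - p j x)\<^sup>2)" for x y
  proof -
    have sq: "(s - t)\<^sup>2 \<le> 2 * (s\<^sup>2 + t\<^sup>2)" for s t :: real
      using zero_le_power2[of "s + t"] by (simp add: power2_eq_square algebra_simps)
    have "(cmod (f y - f x))\<^sup>2 = (Re (f y) - Re (f x))\<^sup>2 + (Im (f y) - Im (f x))\<^sup>2"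
      by (simp add: cmod_power2)
    also have "\<dots> = ((p 0 y - p 0 x) - (p 1 y - p 1 x))\<^sup>2 + ((p 2 y - p 2 x) - (p 3 y - p 3 x))\<^sup>2"
      unfolding p by (intro arg_cong2[where f = "(+)"] arg_cong[where f = "\<lambda>x. x\<^sup>2"]) (simp_all add: max_def)
    also have "\<dots> \<le> 2 * (\<Sum>j\<in>{0, 1, 2, 3}. (p j y - p j x)\<^sup>2)"
      using sq[of "p 0 y - p 0 x" "p 1 y - p 1 x"] sq[of "p 2 y - p 2 x" "p 3 y - p 3 x"] by simp
    finally show ?thesis .
  qed
  note bound = this
  have "(\<lambda>n. 2 * (\<Sum>j\<in>{0, 1, 2, 3}. \<integral>x. (p j (x + a n) - p j x)\<^sup>2 \<partial>lborel)) \<longlonglongrightarrow> 2 * (\<Sum>j\<in>{0, 1, 2, 3::nat}. 0)"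
    by (intro tendsto_mult_left tendsto_sum p_shift)
  then have *: "(\<lambda>n. 2 * (\<Sum>j\<in>{0, 1, 2, 3}. \<integral>x. (p j (x + a n) - p j x)\<^sup>2 \<partial>lborel)) \<longlonglongrightarrow> 0"
    by simp
  show ?thesis
  proof (rule tendsto_sandwich[OF _ _ tendsto_const *])
    have "(\<integral>x. (cmod (f (x + b) - f x))\<^sup>2 \<partial>lborel)
        \<le> (\<integral>x. 2 * (\<Sum>j\<in>{0, 1, 2, 3}. (p j (x + b) - p j x)\<^sup>2) \<partial>lborel)" for b
    proof (rule integral_mono)
      show "integrable lborel (\<lambda>x. (cmod (f (x + b) - f x))\<^sup>2)"
        using square_integrable_diff[OF square_integrable_shift[OF f] f]
        unfolding square_integrable_def by blast
      show "integrable lborel (\<lambda>x. 2 * (\<Sum>j\<in>{0, 1, 2, 3}. (p j (x + b) - p j x)\<^sup>2))"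
        by (intro integrable_mult_right Bochner_Integration.integrable_sum p_shift(1))
    qed (rule bound)
    also have "(\<integral>x. 2 * (\<Sum>j\<in>{0, 1, 2, 3}. (p j (x + b) - p j x)\<^sup>2) \<partial>lborel)
        = 2 * (\<Sum>j\<in>{0, 1, 2, 3}. \<integral>x. (p j (x + b) - p j x)\<^sup>2 \<partial>lborel)" for b
      using p_shift(1) by (simp del: One_nat_def)
    finally show "\<forall>\<^sub>F n in sequentially. (\<integral>x. (cmod (f (x + a n) - f x))\<^sup>2 \<partial>lborel)
        \<le> 2 * (\<Sum>j\<in>{0, 1, 2, 3}. \<integral>x. (p j (x + a n) - p j x)\<^sup>2 \<partial>lborel)"
      by simp
  qed simp
qed

section \<open>The group of shift operators and its strong continuity\<close>

lemma shift_op_0: "shift_op 0 u = u"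
  by transfer simp

lemma shift_op_shift_op: "shift_op a (shift_op b u) = shift_op (a + b) u"
  by transfer (simp add: add.assoc square_integrable_shift)

text \<open>The group law writes the shift by \<open>a n\<close> as the shift by
  \<open>a n - \<mu>\<close> applied to the vector already shifted by \<open>\<mu>\<close>, which
  reduces the claim to continuity at 0.\<close>

lemma tendsto_shift_op:
  fixes u :: "'a::euclidean_space L2"
  assumes "a \<longlonglongrightarrow> \<mu>"
  shows "(\<lambda>n. shift_op (a n) u) \<longlonglongrightarrow> shift_op \<mu> u"
proof -
  have cmod_sq: "cnj z * z = of_real ((cmod z)\<^sup>2)" for z
    by (metis complex_norm_square mult.commute)
  have *: "(\<lambda>n. Re (cinner (shift_op (b n) v - v) (shift_op (b n) v - v))) \<longlonglongrightarrow> 0"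
    if "b \<longlonglongrightarrow> 0" for b and v :: "'a L2"
    using that by transfer (simp only: cmod_sq integral_complex_of_real Re_complex_of_real L2_shift_continuous)
  define v where "v = shift_op \<mu> u"
  have "(\<lambda>n. a n - \<mu>) \<longlonglongrightarrow> 0" using assms by (simp add: LIM_zero)
  from tendsto_real_sqrt[OF *[OF this, of v]]
  have "(\<lambda>n. norm (shift_op (a n - \<mu>) v - v)) \<longlonglongrightarrow> 0"
    by (simp add: norm_L2_def inner_L2_def)
  then have "(\<lambda>n. shift_op (a n - \<mu>) v) \<longlonglongrightarrow> v"
    using LIM_zero_cancel tendsto_norm_zero_iff by blast
  then show ?thesis unfolding v_def shift_op_shift_op by simp
qed

lemma shift_product_eq: "shift_product n a = shift_op ((\<Sum>k<n. a (Suc k)) /\<^sub>R real n)"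
proof -
  \<comment> \<open>The divisor \<open>c\<close> is separated from the length \<open>m\<close>,
    since it has to stay fixed during the induction. The last list entry acts first on the vector,
    hence \<open>u\<close> is generalized.\<close>
  have "foldr (\<lambda>k. shift_op (a k /\<^sub>R c)) [1..<Suc m] u = shift_op ((\<Sum>k<m. a (Suc k)) /\<^sub>R c) u" for m c u
    by (induction m arbitrary: u)
      (simp_all add: shift_op_0 shift_op_shift_op scaleR_add_right)
  then show ?thesis unfolding shift_product_def by blast
qed

section \<open>The trace of a pure state times a bounded operator\<close>

lemma cinner_diff_right: "cinner u (v - w) = cinner u v - cinner u w"
  using cinner_add_right[of u "v - w" w] by simp

lemma cinner_sum_right: "cinner u (\<Sum>i\<in>I. f i) = (\<Sum>i\<in>I. cinner u (f i))"
proof (induction I rule: infinite_finite_induct)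
  have "cinner u 0 = 0" using cinner_add_right[of u 0 0] by simp
  then show "cinner u (\<Sum>i\<in>I. f i) = (\<Sum>i\<in>I. cinner u (f i))" if "infinite I" for I using that by simp
  show "cinner u (\<Sum>i\<in>{}. f i) = (\<Sum>i\<in>{}. cinner u (f i))" using \<open>cinner u 0 = 0\<close> by simp
qed (simp add: cinner_add_right)

lemma norm_scaleC: "norm (c *\<^sub>C u) = cmod c * norm u"
proof -
  have "cinner (c *\<^sub>C u) (c *\<^sub>C u) = c * cnj (c * cinner u u)"
    by (subst cinner_scaleC_right, subst cinner_commute, subst cinner_scaleC_right) simp
  also have "\<dots> = of_real ((cmod c)\<^sup>2 * Re (cinner u u))"
    using cinner_self(1)[of u] by (metis (no_types) complex_cnj_complex_of_real complex_cnj_mult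
        complex_norm_square mult.assoc of_real_mult of_real_power)
  finally have "inner (c *\<^sub>C u) (c *\<^sub>C u) = (cmod c)\<^sup>2 * inner u u"
    unfolding inner_L2_def by simp
  then show ?thesis by (simp add: norm_L2_def real_sqrt_mult)
qed

lemma tendsto_scaleC:
  assumes "(f \<longlongrightarrow> u) F"
  shows "((\<lambda>x. c *\<^sub>C f x) \<longlongrightarrow> c *\<^sub>C u) F"
proof -
  have "((\<lambda>x. cmod c * norm (f x - u)) \<longlongrightarrow> 0) F"
    using tendsto_mult_left[OF tendsto_norm[OF LIM_zero[OF assms]], of "cmod c"] by simp
  then have "((\<lambda>x. norm (c *\<^sub>C f x - c *\<^sub>C u)) \<longlongrightarrow> 0) F"
    by (simp add: norm_scaleC cL2.scale_right_diff_distrib[symmetric])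
  then show ?thesis using LIM_zero_cancel tendsto_norm_zero_iff by blast
qed

text \<open>The imaginary part of \<open>z\<close> is the real part of \<open>- \<i> * z\<close>.
  This lets continuity of the real inner product carry over to the complex one.\<close>

lemma cinner_eq_inner: "cinner u v = Complex (inner u v) (inner u ((- \<i>) *\<^sub>C v))"
  by (simp add: complex_eq_iff inner_L2_def cinner_scaleC_right del: cL2.scale_minus_left)

lemma tendsto_cinner:
  assumes "(f \<longlongrightarrow> u) F" "(g \<longlongrightarrow> v) F"
  shows "((\<lambda>x. cinner (f x) (g x)) \<longlongrightarrow> cinner u v) F"
  unfolding cinner_eq_inner by (intro tendsto_Complex tendsto_inner tendsto_scaleC assms)

text \<open>The partial sum over \<open>F\<close> is the orthogonal projection onto the span of
  \<open>F\<close>, hence at least as close to \<open>u\<close> as any \<open>v\<close> in that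
  span. Density provides a close \<open>v\<close> supported on a finite \<open>F0\<close>, and the
  estimate holds for every finite \<open>F\<close> containing \<open>F0\<close>.\<close>

lemma orthonormal_basis_expansion:
  assumes E: "orthonormal_basis E"
  shows "((\<lambda>e. cinner e u *\<^sub>C e) has_sum u) E"
  unfolding has_sum_def
proof (rule tendstoI)
  fix r :: real assume "r > 0"
  have orth: "cinner e e' = (if e = e' then 1 else 0)" if "e \<in> E" "e' \<in> E" for e e'
    using E that unfolding orthonormal_basis_def by blast
  have "u \<in> closure (cL2.span E)"
    using E unfolding orthonormal_basis_def by simp
  then obtain v where v: "v \<in> cL2.span E" "dist v u < r"
    using \<open>r > 0\<close> unfolding closure_approachable by blast
  obtain F0 c where F0: "finite F0" "F0 \<subseteq> E" and v_eq: "v = (\<Sum>e\<in>F0. c e *\<^sub>C e)"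
    using v(1) unfolding cL2.span_explicit by blast
  have "dist (\<Sum>e\<in>F. cinner e u *\<^sub>C e) u < r" if F: "finite F" "F0 \<subseteq> F" "F \<subseteq> E" for F
  proof -
    define P where "P = (\<Sum>e\<in>F. cinner e u *\<^sub>C e)"
    define w where "w = (\<Sum>e\<in>F. (cinner e u - (if e \<in> F0 then c e else 0)) *\<^sub>C e)"
    have v_F: "v = (\<Sum>e\<in>F. (if e \<in> F0 then c e else 0) *\<^sub>C e)"
      unfolding v_eq using F by (intro sum.mono_neutral_cong_left) auto
    have w: "P - v = w"
      unfolding P_def v_F w_def by (simp add: sum_subtractf[symmetric] cL2.scale_left_diff_distrib)
    have "cinner e (u - P) = 0" if "e \<in> F" for e
    proof -
      have "cinner e P = (\<Sum>e'\<in>F. if e = e' then cinner e' u else 0)"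
        unfolding P_def cinner_sum_right cinner_scaleC_right
        using that F by (intro sum.cong refl) (auto simp: orth subset_iff)
      then show ?thesis using that F by (simp add: cinner_diff_right)
    qed
    then have "cinner (u - P) e = 0" if "e \<in> F" for e
      using that cinner_commute[of "u - P" e] by simp
    then have "cinner (u - P) w = 0"
      unfolding w_def cinner_sum_right cinner_scaleC_right by simp
    then have "orthogonal (u - P) w"
      unfolding orthogonal_def inner_L2_def by simp
    \<comment> \<open>Because \<open>w = P - v\<close>, the left-hand vector is
      \<open>u - v\<close>.\<close>
    then have "(norm ((u - P) + w))\<^sup>2 = (norm (u - P))\<^sup>2 + (norm w)\<^sup>2"
      by (rule norm_add_Pythagorean)
    then have "(norm (u - P))\<^sup>2 \<le> (norm (u - v))\<^sup>2"
      unfolding w[symmetric] by simp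
    then have "norm (u - P) \<le> norm (u - v)" by (rule power2_le_imp_le) simp
    with v(2) show ?thesis unfolding P_def by (simp add: dist_norm norm_minus_commute)
  qed
  with F0 show "\<forall>\<^sub>F F in finite_subsets_at_top E. dist (\<Sum>e\<in>F. cinner e u *\<^sub>C e) u < r"
    unfolding eventually_finite_subsets_at_top by blast
qed

text \<open>Each term is \<open>cinner u (A e) * cinner e u\<close>, that is,
  \<open>cinner u (A (cinner e u *\<^sub>C e))\<close>. Finite sums move inside \<open>A\<close>,
  and continuity applies to the expansion of \<open>u\<close>.\<close>

lemma has_sum_trace_pure_state:
  assumes A: "A \<in> bounded_operators" and E: "orthonormal_basis E"
  shows "((\<lambda>e. cinner e ((pure_state u \<circ> A) e)) has_sum cinner u (A u)) E"
proof -
  interpret A: bounded_linear A using A unfolding bounded_operators_def by blast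
  have scale: "A (c *\<^sub>C v) = c *\<^sub>C A v" for c v
    using A unfolding bounded_operators_def by blast
  have "sum (\<lambda>e. cinner e ((pure_state u \<circ> A) e)) = (\<lambda>F. cinner u (A (\<Sum>e\<in>F. cinner e u *\<^sub>C e)))"
    by (simp add: fun_eq_iff A.sum cinner_sum_right scale cinner_scaleC_right pure_state_def mult.commute)
  moreover have "((\<lambda>F. cinner u (A (\<Sum>e\<in>F. cinner e u *\<^sub>C e))) \<longlongrightarrow> cinner u (A u)) (finite_subsets_at_top E)"
    using orthonormal_basis_expansion[OF E, of u] unfolding has_sum_def
    by (intro tendsto_cinner tendsto_const A.tendsto)
  ultimately show ?thesis unfolding has_sum_def by (simp only:)
qed

text \<open>Every basis yields the same sum; the given basis \<open>E\<close> makes the described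
  value unique.\<close>

lemma op_trace_pure_state:
  assumes "A \<in> bounded_operators" and "orthonormal_basis (E :: 'a::euclidean_space L2 set)"
  shows "op_trace (pure_state u \<circ> A) = cinner u (A (u :: 'a L2))"
  unfolding op_trace_def
  using has_sum_trace_pure_state[OF assms(1), of _ u] assms(2) by (intro the_equality) (blast intro: has_sum_unique)+

lemma tendsto_op_trace_pure_state:
  fixes u :: "'a::euclidean_space L2"
  assumes A: "A \<in> bounded_operators" and lim: "f \<longlonglongrightarrow> u"
  shows "(\<lambda>n. op_trace (pure_state (f n) \<circ> A)) \<longlonglongrightarrow> op_trace (pure_state u \<circ> A)"
proof (cases "\<exists>E :: 'a L2 set. orthonormal_basis E")
  case True
  then obtain E :: "'a L2 set" where "orthonormal_basis E" ..
  note trace = op_trace_pure_state[OF A this]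
  interpret A: bounded_linear A using A unfolding bounded_operators_def by blast
  show ?thesis unfolding trace by (intro tendsto_cinner A.tendsto lim)
next
  case False
  \<comment> \<open>Without an orthonormal basis, the description defining \<open>op_trace\<close> does not depend on the
    operator. This makes a proof that orthonormal bases exist unnecessary.\<close>
  then have "op_trace T = (THE t. True)" for T :: "'a L2 \<Rightarrow> 'a L2"
    unfolding op_trace_def by simp
  then show ?thesis by simp
qed

section \<open>Convergence of the random pure states\<close>

theorem theorem4p1:
  fixes M :: "'w measure"
    and \<xi> :: "nat \<Rightarrow> 'w \<Rightarrow> real ^ 'd"
    and \<mu> :: "real ^ 'd"
    and u :: "(real ^ 'd) L2"
  assumes "prob_space M"
    and "prob_space.indep_vars M (\<lambda>_. borel) \<xi> {1..}"
    and "\<And>n. n \<ge> 1 \<Longrightarrow> distr M borel (\<xi> n) = distr M borel (\<xi> 1)"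
    and "integrable M (\<xi> 1)"
    and "integral\<^sup>L M (\<xi> 1) = \<mu>"
  shows "converges_as_WOT M
           (\<lambda>n \<omega>. pure_state (shift_product n (\<lambda>k. \<xi> k \<omega>) u))
           (pure_state (shift_op \<mu> u))"
proof -
  interpret prob_space M by fact
  \<comment> \<open>The random vectors are numbered from 1, the strong law from 0.\<close>
  have Suc_image: "{1..} = range Suc"
    by (auto simp: image_iff Suc_le_eq gr0_conv_Suc)
  have "AE \<omega> in M. (\<lambda>n. (\<Sum>k<n. \<xi> (Suc k) \<omega>) /\<^sub>R real n) \<longlonglongrightarrow> \<mu>"
    unfolding assms(5)[symmetric] One_nat_def
  proof (rule strong_law_of_large_numbers)
    show "indep_vars (\<lambda>_. borel) (\<lambda>k. \<xi> (Suc k)) UNIV"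
      using assms(2) unfolding Suc_image by (rule indep_vars_reindex) simp
    show "distr M borel (\<xi> (Suc k)) = distr M borel (\<xi> (Suc 0))" for k
      using assms(3)[of "Suc k"] by simp
  qed (use assms(1, 4) in simp_all)
  then have "AE \<omega> in M. (\<lambda>n. shift_product n (\<lambda>k. \<xi> k \<omega>) u) \<longlonglongrightarrow> shift_op \<mu> u"
    unfolding shift_product_eq by eventually_elim (rule tendsto_shift_op)
  \<comment> \<open>The exceptional null set comes from the strong law alone, so it is the same for
    all operators \<open>A\<close>.\<close>
  then show ?thesis
    unfolding converges_as_WOT_def
    by (intro ballI) (auto elim!: eventually_mono intro: tendsto_op_trace_pure_state)
qed

end
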